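(* Let $w\ge 1$ be an integer and let $\mathcal S_w$ be the set of nonzero configurations $x\in\{0,1\}^{\mathbb Z}$ with $\operatorname{supp}(x)\subseteq[-w,w]$ and $x_0=0$. For $x\in\mathcal S_w$ let $$H(x)=\max\{h\ge 0: F^t(x)_0=0\text{ for all }0\le t\le h\}.$$ Then $$\max_{x\in\mathcal S_w}H(x)=2\left\lceil\frac w2\right\rceil\qquad\text{and}\qquad \#\left\{x\in\mathcal S_w: H(x)=2\left\lceil\frac w2\right\rceil\right\}=2^w-1.$$
   Context: Rule 30 is the map $F:\{0,1\}^{\mathbb Z}\to\{0,1\}^{\mathbb Z}$ given by $F(x)_i=x_{i-1}\oplus(x_i\lor x_{i+1})$, where $\oplus$ is addition modulo $2$ and $\lor$ is Boolean disjunction. $F^t$ is the $t$-fold iterate, with $F^0(x)=x$. The support is $\operatorname{supp}(x)=\{i\in\mathbb Z:x_i=1\}$. *)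

theory Defs
  imports Complex_Main
begin

text \<open>A configuration \<open>x : \<int> \<rightarrow> {0,1}\<close> is a Boolean function; \<^const>\<open>True\<close> is 1
  and \<^const>\<open>False\<close> is 0, so that \<open>\<noteq>\<close> on Booleans is addition modulo 2.\<close>

type_synonym config = "int \<Rightarrow> bool"

definition rule30 :: "config \<Rightarrow> config" where
  "rule30 x = (\<lambda>i. x (i - 1) \<noteq> (x i \<or> x (i + 1)))"

definition supp :: "config \<Rightarrow> int set" where
  "supp x = {i. x i}"

definition S :: "nat \<Rightarrow> config set" where
  "S w = {x. x \<noteq> (\<lambda>_. False) \<and> supp x \<subseteq> {- int w..int w} \<and> \<not> x 0}"

definition zero_times :: "config \<Rightarrow> nat set" where
  "zero_times x = {h. \<forall>t\<le>h. \<not> (rule30 ^^ t) x 0}"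

text \<open>\<^const>\<open>Max\<close> is meaningful only on finite nonempty sets. For \<open>x \<in> S w\<close> the set
  \<open>zero_times x\<close> contains 0, but its finiteness is not evident from the definitions.\<close>

definition H :: "config \<Rightarrow> nat" where
  "H x = Max (zero_times x)"

lemma finite_S: "finite (S w)"
proof (rule finite_subset)
  show "S w \<subseteq> (\<lambda>A i. i \<in> A) ` Pow {- int w..int w}"
  proof
    fix x assume "x \<in> S w"
    then have "supp x \<in> Pow {- int w..int w}" by (simp add: S_def)
    moreover have "x = (\<lambda>i. i \<in> supp x)" by (simp add: supp_def)
    ultimately show "x \<in> (\<lambda>A i. i \<in> A) ` Pow {- int w..int w}" by blast
  qed
qed simp

lemma S_nonempty: "w \<ge> 1 \<Longrightarrow> S w \<noteq> {}"
proof -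
  assume "w \<ge> 1"
  then have "(\<lambda>i. i = 1) \<in> S w" by (auto simp: S_def supp_def fun_eq_iff)
  then show ?thesis by blast
qed

lemma zero_in_zero_times: "x \<in> S w \<Longrightarrow> 0 \<in> zero_times x"
  by (simp add: S_def zero_times_def)

end

theory Submission
  imports Defs
begin

text \<open>
  Suppose that the cell at the origin stays 0. Then the cell at 1 obeys
  \<open>x\<^sub>1 \<mapsto> x\<^sub>1 \<or> x\<^sub>2\<close>, and the leftmost 1 in the right half moves left by one cell per step until it
  reaches position 1, where it stays. Hence the whole history of the cell at 1 depends only on the
  position \<open>m\<close> of the leftmost 1 in the right half. Rule 30 is a bijection in its left argument,
  \<open>x\<^sub>i\<^sub>-\<^sub>1 = F(x)\<^sub>i \<oplus> (x\<^sub>i \<or> x\<^sub>i\<^sub>+\<^sub>1)\<close>, so the histories of the cells 0 and 1 in turn determine the left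
  half: the cell at \<open>- k\<close> must be 1 exactly if \<open>k\<close> is odd and \<open>k \<ge> m\<close>, or \<open>k\<close> is even and \<open>k = m\<close>.

  This condition for \<open>k \<le> h\<close> (\<open>balanced x h\<close>) is not only necessary but equivalent to the origin
  being 0 at all times up to \<open>h\<close>. The reason is that it propagates exactly: if \<open>x\<^sub>0 = 0\<close>, then
  \<open>x\<close> satisfies it up to \<open>h + 1\<close> if and only if \<open>F(x)\<^sub>0 = 0\<close> and \<open>F(x)\<close> satisfies it up to \<open>h\<close>
  (\<open>balanced_Suc_iff\<close>).

  Let now \<open>x \<in> S w\<close> satisfy the condition up to \<open>w\<close>. If the right half were empty, the prescribed
  left half would be empty too, and \<open>x\<close> would be zero; so \<open>m \<le> w\<close>. At every \<open>k > w\<close> the condition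
  then asks for a 1 if \<open>k\<close> is odd and for a 0 if \<open>k\<close> is even, while \<open>x\<close> is 0 there. So it first
  fails at the first odd number above \<open>w\<close>, which is \<open>N + 1\<close> for \<open>N = 2\<lceil>w/2\<rceil>\<close>. Thus \<open>N\<close> is the
  maximum, and it is attained exactly by those configurations whose left half within the window is
  the prescribed function of the right half. The right half can be any nonempty subset of \<open>{1..w}\<close>,
  which gives \<open>2 ^ w - 1\<close>.
\<close>

section \<open>The left half forced by a vanishing origin\<close>

definition occupied_upto :: "config \<Rightarrow> nat \<Rightarrow> bool" where
  "occupied_upto x n \<longleftrightarrow> (\<exists>j\<in>{1..n}. x (int j))"

text \<open>In terms of the position \<open>m\<close> of the leftmost 1 at a positive cell, this says \<open>m \<le> k\<close> for odd \<open>k\<close>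
  and \<open>m = k\<close> for even \<open>k\<close>. The formulation through \<^const>\<open>occupied_upto\<close> also covers an empty right
  half, where \<open>m\<close> is infinite.\<close>

definition forced :: "config \<Rightarrow> nat \<Rightarrow> bool" where
  "forced x k \<longleftrightarrow> occupied_upto x k \<and> (odd k \<or> \<not> occupied_upto x (k - 1))"

definition balanced :: "config \<Rightarrow> nat \<Rightarrow> bool" where
  "balanced x h \<longleftrightarrow> (\<forall>k\<in>{1..h}. x (- int k) = forced x k)"

lemma occupied_upto_mono: "occupied_upto x m \<Longrightarrow> m \<le> n \<Longrightarrow> occupied_upto x n"
  by (force simp: occupied_upto_def)

lemma occupied_upto_1: "occupied_upto x (Suc 0) \<longleftrightarrow> x 1"
  by (simp add: occupied_upto_def)

lemma forced_0: "\<not> forced x 0"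
  by (simp add: forced_def occupied_upto_def)

lemma balanced_antimono: "balanced x n \<Longrightarrow> m \<le> n \<Longrightarrow> balanced x m"
  by (simp add: balanced_def)

text \<open>The leftmost 1 at a positive cell has only zeros to its left, so it moves left by one cell, or
  stays put if it is at 1 already; a 1 cannot appear further to the left. For \<open>n = 0\<close> the equivalence
  fails, since the 1 does not move on to the origin.\<close>

lemma occupied_upto_rule30:
  assumes x0: "\<not> x 0" and "n \<ge> 1"
  shows "occupied_upto (rule30 x) n \<longleftrightarrow> occupied_upto x (Suc n)"
proof
  assume "occupied_upto (rule30 x) n"
  then obtain j where j: "1 \<le> j" "j \<le> n" "rule30 x (int j)"
    by (auto simp: occupied_upto_def)
  then have "x (int (j - 1)) \<or> x (int j) \<or> x (int (Suc j))"
    by (auto simp: rule30_def of_nat_diff algebra_simps)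
  moreover have "1 \<le> j - 1" if "x (int (j - 1))"
    using that x0 by (cases "j - 1") auto
  ultimately have "\<exists>i. 1 \<le> i \<and> i \<le> Suc n \<and> x (int i)"
    using j by (elim disjE) (rule exI[of _ "j - 1"] exI[of _ j] exI[of _ "Suc j"]; simp)+
  then show "occupied_upto x (Suc n)" by (auto simp: occupied_upto_def)
next
  assume "occupied_upto x (Suc n)"
  then have ex: "\<exists>j. 1 \<le> j \<and> j \<le> Suc n \<and> x (int j)" by (auto simp: occupied_upto_def)
  define m where "m = (LEAST j. 1 \<le> j \<and> j \<le> Suc n \<and> x (int j))"
  have m: "1 \<le> m" "m \<le> Suc n" "x (int m)"
    using LeastI_ex[OF ex] by (auto simp: m_def)
  have below: "\<not> x (int i)" if "i < m" for i
  proof (cases "i = 0")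
    case False
    then show ?thesis
      using not_less_Least[OF that[unfolded m_def]] that \<open>m \<le> Suc n\<close> by auto
  qed (use x0 in simp)
  show "occupied_upto (rule30 x) n"
  proof (cases "m = 1")
    case True
    then have "rule30 x (int 1)" using m x0 by (simp add: rule30_def)
    then show ?thesis using \<open>n \<ge> 1\<close> by (auto simp: occupied_upto_def intro!: bexI[of _ 1])
  next
    case False
    then have "\<not> x (int (m - 2))" "\<not> x (int (m - 1))" "2 \<le> m"
      using below[of "m - 2"] below[of "m - 1"] m by auto
    then have "rule30 x (int (m - 1))" using m by (simp add: rule30_def of_nat_diff)
    then show ?thesis using m False by (auto simp: occupied_upto_def intro!: bexI[of _ "m - 1"])
  qed
qed

text \<open>This is rule 30 at the cell \<open>- k\<close>, solved for its left neighbour, with the prescribed values in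
  place of the actual ones. Let \<open>m\<close> be the position of the leftmost 1 at a positive cell of \<open>x\<close>, so
  that in \<open>F(x)\<close> it is at \<open>m - 1\<close>, or still at 1 if \<open>m = 1\<close>. For even \<open>k\<close> the equation then reads
  \<open>[m \<le> k + 1] = [m = k + 1] \<oplus> ([m = k] \<or> [m \<le> k - 1])\<close>, and for odd \<open>k\<close> it reads
  \<open>[m = k + 1] = [m \<le> k + 1] \<oplus> ([m \<le> k] \<or> [m = k - 1])\<close>.\<close>

lemma forced_recurrence:
  assumes x0: "\<not> x 0" and "k \<ge> 1"
  shows "forced x (Suc k) \<longleftrightarrow> forced (rule30 x) k \<noteq> (forced x k \<or> forced x (k - 1))"
proof -
  have shift: "occupied_upto (rule30 x) k \<longleftrightarrow> occupied_upto x (Suc k)"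
    "even k \<Longrightarrow> occupied_upto (rule30 x) (k - 1) \<longleftrightarrow> occupied_upto x k"
    using occupied_upto_rule30[of x k] occupied_upto_rule30[of x "k - 1"] x0 \<open>k \<ge> 1\<close>
    by (cases "k = 1"; simp)+
  have mono: "occupied_upto x (k - 1) \<Longrightarrow> occupied_upto x k"
    "occupied_upto x k \<Longrightarrow> occupied_upto x (Suc k)"
    by (auto elim: occupied_upto_mono)
  show ?thesis
  proof (cases "even k")
    case True
    then have "odd (k - 1)" "k \<noteq> 1" using \<open>k \<ge> 1\<close> by auto
    then have "forced x (Suc k) = occupied_upto x (Suc k)"
      "forced (rule30 x) k \<longleftrightarrow> occupied_upto x (Suc k) \<and> \<not> occupied_upto x k"
      "forced x k \<longleftrightarrow> occupied_upto x k \<and> \<not> occupied_upto x (k - 1)"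
      "forced x (k - 1) = occupied_upto x (k - 1)"
      using True shift by (simp_all add: forced_def)
    then show ?thesis using mono \<open>k \<noteq> 1\<close> by argo
  next
    case False
    then have "forced x (Suc k) \<longleftrightarrow> occupied_upto x (Suc k) \<and> \<not> occupied_upto x k"
      "forced (rule30 x) k = occupied_upto x (Suc k)"
      "forced x k = occupied_upto x k"
      "forced x (k - 1) \<Longrightarrow> occupied_upto x (k - 1)"
      using shift by (simp_all add: forced_def)
    then show ?thesis using mono by argo
  qed
qed

text \<open>Rule 30 at the cell \<open>- k\<close> and the recurrence above are the same equation, one for the actual and one
  for the prescribed values. From left to right it is solved for the new value at \<open>- k\<close>; from right
  to left it is solved for the old value at \<open>- (k + 1)\<close>, moving outwards from the origin. The new
  value at the origin itself decides whether the cell at \<open>- 1\<close> is as prescribed.\<close>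

lemma balanced_Suc_iff:
  assumes x0: "\<not> x 0"
  shows "balanced x (Suc h) \<longleftrightarrow> \<not> rule30 x 0 \<and> balanced (rule30 x) h"
proof -
  have first: "rule30 x 0 \<longleftrightarrow> x (- 1) \<noteq> forced x 1"
    using x0 by (simp add: rule30_def forced_def occupied_upto_1)
  have next_cell: "rule30 x (- int k) \<longleftrightarrow>
      x (- int (Suc k)) \<noteq> (x (- int k) \<or> x (- int (k - 1)))" if "k \<ge> 1" for k
  proof -
    have "- int k - 1 = - int (Suc k)" "- int k + 1 = - int (k - 1)" using that by auto
    then show ?thesis by (simp only: rule30_def)
  qed
  show ?thesis
  proof
    assume bal: "balanced x (Suc h)"
    then have cell: "x (- int k) = forced x k" if "k \<le> Suc h" for k
      using that x0 by (cases "k = 0") (auto simp: balanced_def forced_0)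
    have "\<not> rule30 x 0" using first cell[of 1] by simp
    moreover have "rule30 x (- int k) = forced (rule30 x) k" if k: "k \<in> {1..h}" for k
    proof -
      have "1 \<le> k" "k \<le> Suc h" "k - 1 \<le> Suc h" "Suc k \<le> Suc h" using k by auto
      then show ?thesis
        using forced_recurrence[of x k] x0 next_cell[of k] cell[of k] cell[of "k - 1"] cell[of "Suc k"]
        by argo
    qed
    ultimately show "\<not> rule30 x 0 \<and> balanced (rule30 x) h" by (simp add: balanced_def)
  next
    assume R: "\<not> rule30 x 0 \<and> balanced (rule30 x) h"
    have "k \<le> Suc h \<longrightarrow> x (- int k) = forced x k" for k
    proof (induction k rule: less_induct)
      case (less n)
      consider "n = 0" | "n = 1" | k where "n = Suc k" "1 \<le> k" by (cases n) fastforce+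
      then show ?case
      proof cases
        case 1
        then show ?thesis using x0 by (simp add: forced_0)
      next
        case 2
        then show ?thesis using first R by simp
      next
        case (3 k)
        show ?thesis
        proof
          assume "n \<le> Suc h"
          then have "rule30 x (- int k) = forced (rule30 x) k"
            using R 3 by (auto simp: balanced_def)
          moreover have "x (- int k) = forced x k" "x (- int (k - 1)) = forced x (k - 1)"
            using less[of k] less[of "k - 1"] 3 \<open>n \<le> Suc h\<close> by auto
          ultimately show "x (- int n) = forced x n"
            using forced_recurrence[of x k] x0 next_cell[of k] 3 by auto
        qed
      qed
    qed
    then show "balanced x (Suc h)" by (simp add: balanced_def)
  qed
qed

lemma zero_times_iff_balanced: "h \<in> zero_times x \<longleftrightarrow> \<not> x 0 \<and> balanced x h"
proof (induction h arbitrary: x)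
  case 0
  show ?case by (simp add: zero_times_def balanced_def)
next
  case (Suc h)
  have "Suc h \<in> zero_times x \<longleftrightarrow> \<not> x 0 \<and> h \<in> zero_times (rule30 x)"
    by (simp add: zero_times_def less_Suc_eq_le[symmetric] All_less_Suc2 funpow_Suc_right
        del: funpow.simps)
  then show ?case using Suc balanced_Suc_iff[of x h] by auto
qed

section \<open>Configurations in a finite window\<close>

lemma S_outside: "x \<in> S w \<Longrightarrow> int w < \<bar>i\<bar> \<Longrightarrow> \<not> x i"
  by (force simp: S_def supp_def)

lemma occupied_upto_window:
  assumes "x \<in> S w" "w \<le> n"
  shows "occupied_upto x n \<longleftrightarrow> occupied_upto x w"
proof
  assume "occupied_upto x n"
  then obtain j where j: "1 \<le> j" "x (int j)" by (auto simp: occupied_upto_def)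
  then have "j \<le> w" using S_outside[OF assms(1), of "int j"] by fastforce
  then show "occupied_upto x w" using j by (auto simp: occupied_upto_def)
qed (use assms occupied_upto_mono in blast)

text \<open>With an empty right half the prescribed left half is empty as well, which leaves only the zero
  configuration.\<close>

lemma balanced_imp_occupied:
  assumes x: "x \<in> S w" and bal: "balanced x w"
  shows "occupied_upto x w"
proof (rule ccontr)
  assume emp: "\<not> occupied_upto x w"
  have "\<not> x i" for i
  proof -
    consider "int w < \<bar>i\<bar>" | "i = 0" | j where "i = int j" "j \<in> {1..w}"
      | j where "i = - int j" "j \<in> {1..w}"
    proof -
      have "nat \<bar>i\<bar> \<in> {1..w}" if "i \<noteq> 0" "\<not> int w < \<bar>i\<bar>" using that by auto
      moreover have "i = int (nat \<bar>i\<bar>) \<or> i = - int (nat \<bar>i\<bar>)" by auto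
      ultimately show ?thesis using that by blast
    qed
    then show ?thesis
    proof cases
      case 1
      then show ?thesis by (rule S_outside[OF x])
    next
      case 2
      then show ?thesis using x by (simp add: S_def)
    next
      case 3
      then show ?thesis using emp by (auto simp: occupied_upto_def)
    next
      case (4 j)
      then have "\<not> occupied_upto x j" using emp occupied_upto_mono[of x j w] by auto
      then show ?thesis using bal 4 by (auto simp: balanced_def forced_def)
    qed
  qed
  then show False using x by (auto simp: S_def fun_eq_iff)
qed

text \<open>At an odd \<open>k\<close> beyond the window, a nonempty right half prescribes a 1 at \<open>- k\<close>, but that cell is
  outside the support.\<close>

lemma not_balanced_beyond_window:
  assumes x: "x \<in> S w" and "odd k" "w < k"
  shows "\<not> balanced x k"
proof
  assume bal: "balanced x k"
  have "occupied_upto x k"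
    using balanced_imp_occupied[OF x balanced_antimono[OF bal]] occupied_upto_window[OF x, of k]
      \<open>w < k\<close> by simp
  then have "forced x k" using \<open>odd k\<close> by (simp add: forced_def)
  then have "x (- int k)" using bal \<open>w < k\<close> by (auto simp: balanced_def)
  then show False using S_outside[OF x, of "- int k"] \<open>w < k\<close> by auto
qed

text \<open>The first cell beyond the window is prescribed to be 0 if its distance from the origin is
  even.\<close>

lemma balanced_Suc_window:
  assumes x: "x \<in> S w" and "odd w"
  shows "balanced x (Suc w) \<longleftrightarrow> balanced x w"
proof
  assume bal: "balanced x w"
  have "\<not> x (- int (Suc w))" by (rule S_outside[OF x]) simp
  moreover have "\<not> forced x (Suc w)"
    using \<open>odd w\<close> occupied_upto_window[OF x, of "Suc w"] by (simp add: forced_def)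
  ultimately show "balanced x (Suc w)" using bal
    by (auto simp: balanced_def le_Suc_eq)
qed (auto elim: balanced_antimono)

text \<open>The left half is a function of the right half, and any nonempty right half is admissible.\<close>

lemma card_balanced: "card {x \<in> S w. balanced x w} = 2 ^ w - 1"
proof -
  define right where "right x = {j\<in>{1..w}. x (int j)}" for x :: config
  define ext where "ext A i \<longleftrightarrow>
    (if i > 0 then nat i \<in> A else - i \<in> {1..int w} \<and> forced (\<lambda>j. nat j \<in> A) (nat (- i)))"
    for A and i :: int
  have occ_cong: "occupied_upto x n = occupied_upto y n"
    if "\<And>j. 1 \<le> j \<Longrightarrow> j \<le> n \<Longrightarrow> x (int j) = y (int j)" for x y n
    using that by (auto simp: occupied_upto_def)
  have forced_cong: "forced x k = forced y k"
    if "\<And>j. 1 \<le> j \<Longrightarrow> j \<le> k \<Longrightarrow> x (int j) = y (int j)" for x y k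
  proof -
    have "occupied_upto x k = occupied_upto y k" "occupied_upto x (k - 1) = occupied_upto y (k - 1)"
      by (rule occ_cong; use that in simp)+
    then show ?thesis by (simp add: forced_def)
  qed
  have "bij_betw right {x \<in> S w. balanced x w} (Pow {1..w} - {{}})"
  proof (rule bij_betw_byWitness[where f' = ext])
    show "\<forall>x\<in>{x \<in> S w. balanced x w}. ext (right x) = x"
    proof (intro ballI ext)
      fix x i assume "x \<in> {x \<in> S w. balanced x w}"
      then have x: "x \<in> S w" and bal: "balanced x w" by auto
      show "ext (right x) i = x i"
      proof (cases "i > 0")
        case True
        then show ?thesis using S_outside[OF x, of i]
          by (cases "i \<le> int w") (auto simp: ext_def right_def)
      next
        case False
        show ?thesis
        proof (cases "- i \<in> {1..int w}")
          case True
          have "forced (\<lambda>j. nat j \<in> right x) (nat (- i)) = forced x (nat (- i))"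
            by (rule forced_cong) (use True in \<open>auto simp: right_def\<close>)
          moreover have "nat (- i) \<in> {1..w}" using True by auto
          then have "x (- int (nat (- i))) = forced x (nat (- i))"
            using bal unfolding balanced_def by (rule bspec[rotated])
          ultimately show ?thesis using True False by (simp add: ext_def)
        next
          case out: False
          then have "\<not> x i"
            using False x S_outside[OF x, of i] by (cases "i = 0") (auto simp: S_def)
          then show ?thesis using out False by (auto simp: ext_def)
        qed
      qed
    qed
    show "\<forall>A\<in>Pow {1..w} - {{}}. right (ext A) = A"
      by (auto simp: right_def ext_def)
    show "right ` {x \<in> S w. balanced x w} \<subseteq> Pow {1..w} - {{}}"
      using balanced_imp_occupied by (fastforce simp: right_def occupied_upto_def)
    show "ext ` (Pow {1..w} - {{}}) \<subseteq> {x \<in> S w. balanced x w}"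
    proof
      fix x assume "x \<in> ext ` (Pow {1..w} - {{}})"
      then obtain A where A: "A \<subseteq> {1..w}" "A \<noteq> {}" and xA: "x = ext A" by auto
      obtain a where a: "a \<in> A" using A by auto
      have "ext A (int a)" using a A by (auto simp: ext_def)
      then have "x \<noteq> (\<lambda>_. False)" using xA by metis
      moreover have "i \<in> {- int w..int w}" if "x i" for i
      proof (cases "i > 0")
        case True
        then have "nat i \<in> {1..w}" using that A by (auto simp: xA ext_def)
        then show ?thesis using True by auto
      qed (use that in \<open>auto simp: xA ext_def\<close>)
      then have "supp x \<subseteq> {- int w..int w}" by (auto simp: supp_def)
      moreover have "\<not> x 0" by (simp add: xA ext_def)
      moreover have "balanced x w"
        unfolding balanced_def
      proof
        fix k assume k: "k \<in> {1..w}"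
        have "forced (\<lambda>j. nat j \<in> A) k = forced (ext A) k"
          by (rule forced_cong) (auto simp: ext_def)
        then show "x (- int k) = forced x k" using k by (auto simp: xA ext_def)
      qed
      ultimately show "x \<in> {x \<in> S w. balanced x w}" by (simp add: S_def)
    qed
  qed
  then have "card {x \<in> S w. balanced x w} = card (Pow {1..w} - {{}})" by (rule bij_betw_same_card)
  also have "\<dots> = 2 ^ w - 1" by (simp add: card_Diff_singleton card_Pow)
  finally show ?thesis .
qed

section \<open>The maximal time\<close>

theorem theorem6:
  fixes w :: nat
  assumes "w \<ge> 1"
  shows "(\<forall>x\<in>S w. finite (zero_times x)) \<and>
    Max (H ` S w) = 2 * nat \<lceil>real w / 2\<rceil> \<and>
    card {x \<in> S w. H x = 2 * nat \<lceil>real w / 2\<rceil>} = 2 ^ w - 1"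
proof -
  define N where "N = 2 * nat \<lceil>real w / 2\<rceil>"
  have N: "N = (if even w then w else Suc w)"
  proof (cases "even w")
    case True
    then show ?thesis by (auto simp: N_def elim!: evenE)
  next
    case False
    then obtain v where v: "w = 2 * v + 1" by (elim oddE)
    have "\<lceil>real w / 2\<rceil> = int v + 1" unfolding v by (rule ceiling_unique) auto
    then show ?thesis using False v by (simp add: N_def nat_add_distrib)
  qed
  have zt: "h \<in> zero_times x \<longleftrightarrow> balanced x h" if "x \<in> S w" for x h
    using that by (simp add: zero_times_iff_balanced S_def)
  have bound: "h \<le> N" if x: "x \<in> S w" and h: "h \<in> zero_times x" for x h
  proof (rule ccontr)
    assume "\<not> h \<le> N"
    then have "balanced x (Suc N)" using balanced_antimono[of x h "Suc N"] zt[OF x] h by simp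
    moreover have "odd (Suc N)" "w < Suc N" using N by auto
    ultimately show False using not_balanced_beyond_window[OF x] by blast
  qed
  have fin: "finite (zero_times x)" if "x \<in> S w" for x
    using bound[OF that] finite_nat_set_iff_bounded_le by blast
  have H_le: "H x \<le> N" if "x \<in> S w" for x
    unfolding H_def using Max_in[OF fin[OF that]] zero_in_zero_times[OF that] bound[OF that] by blast
  have H_eq: "H x = N \<longleftrightarrow> balanced x w" if x: "x \<in> S w" for x
  proof -
    have "H x = N \<longleftrightarrow> N \<in> zero_times x"
      unfolding H_def
      using Max_in[OF fin[OF x]] zero_in_zero_times[OF x] Max_eqI[OF fin[OF x] bound[OF x]] by blast
    also have "\<dots> \<longleftrightarrow> balanced x w"
      using zt[OF x] N balanced_Suc_window[OF x] by auto
    finally show ?thesis .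
  qed
  have card: "card {x \<in> S w. H x = N} = 2 ^ w - 1"
    unfolding card_balanced[symmetric] by (rule arg_cong[where f = card]) (use H_eq in auto)
  have "(2::nat) \<le> 2 ^ w" using power_increasing[OF assms, of "2::nat"] by simp
  then have "card {x \<in> S w. H x = N} \<noteq> 0" using card by linarith
  then have "{x \<in> S w. H x = N} \<noteq> {}" by force
  then obtain x where "x \<in> S w" "H x = N" by auto
  then have "Max (H ` S w) = N"
    using H_le finite_S by (intro Max_eqI) auto
  with fin card show ?thesis unfolding N_def by simp
qed

end
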